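(* Let $G$ be a digraph of order $n$ with dichromatic number $r$. Then: (i) If $r\mid n$, then $$LE(G)\leq\left(1+\frac{1}{3r^2}-\frac{1}{r}\right)n^3-\frac{1}{2r}n^2+\frac{1}{6}n,$$ with equality if and only if $G=V^1\vee\cdots\vee V^r$ where each $V^i$ is a transitive tournament on $n_i=\frac{n}{r}$ vertices. (ii) If $r\nmid n$, then $$LE(G)\leq n^3+\frac{1}{6}n+p-q,$$ where $p=\left\lceil\frac{n}{r}\right\rceil^2\left(n-r\left\lfloor\frac{n}{r}\right\rfloor\right)\left(\frac{1}{3}\left\lceil\frac{n}{r}\right\rceil-n-\frac{1}{2}\right)$ and $q=\left\lfloor\frac{n}{r}\right\rfloor^2\left(n-r\left\lceil\frac{n}{r}\right\rceil\right)\left(\frac{1}{3}\left\lfloor\frac{n}{r}\right\rfloor-n-\frac{1}{2}\right)$. Equality holds if and only if $G=V^1\vee\cdots\vee V^r$ where each $V^i$ is a transitive tournament on $n_i$ vertices, with $n_s=\left\lceil\frac{n}{r}\right\rceil$ for $s=1,\ldots,n-r\left\lfloor\frac{n}{r}\right\rfloor$ and $n_t=\left\lfloor\frac{n}{r}\right\rfloor$ for $t=n-r\left\lfloor\frac{n}{r}\right\rfloor+1,\ldots,r$.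
   Context: All digraphs are finite, have no loops or multiple arcs, and are weakly connected (standing assumption). For a digraph $G$ with vertex set $\{v_1,\dots,v_n\}$, $d_i^+$ is the outdegree of $v_i$, $A(G)$ the adjacency matrix, $D^+(G)=\mathrm{diag}(d_1^+,\dots,d_n^+)$, and $L(G)=D^+(G)-A(G)$ the Laplacian matrix; $LE(G)=\sum_{i=1}^n\lambda_i^2$ where $\lambda_i$ are the eigenvalues of $L(G)$. The dichromatic number of $G$ is the least $r$ such that $\mathcal V(G)$ can be partitioned into $r$ sets each inducing a subdigraph with no directed cycle. The join $G_1\vee G_2$ of vertex-disjoint digraphs has vertex set $\mathcal V(G_1)\cup\mathcal V(G_2)$ and arc set $\mathcal A(G_1)\cup\mathcal A(G_2)\cup\{(u,v),(v,u): u\in\mathcal V(G_1), v\in\mathcal V(G_2)\}$. A transitive tournament is an orientation of a complete graph such that $(u,v),(v,w)$ arcs imply $(u,w)$ is an arc. *)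

theory Defs
  imports
    "Graph_Theory.Graph_Theory"
    "Jordan_Normal_Form.Char_Poly"
    "HOL-Library.Disjoint_Sets"
    "HOL-Library.Complex_Order"
begin

text \<open>Digraphs without multiple arcs are the \<open>pair_pre_digraph\<close>s of Graph_Theory; the predicate
  \<open>pair_digraph\<close> adds well-formedness, finiteness and the absence of loops. Antiparallel arcs
  \<open>(u, v)\<close>, \<open>(v, u)\<close> are allowed, and such a pair is a directed cycle of length two.\<close>

text \<open>In the matrices below, the list \<open>vs\<close> enumerates the vertex set without repetition, and row
  and column \<open>i\<close> (counted from 0) belong to the vertex \<open>vs ! i\<close>.\<close>

definition adjacency_matrix :: "'a pair_pre_digraph \<Rightarrow> 'a list \<Rightarrow> complex mat" where
  "adjacency_matrix G vs = Matrix.mat (length vs) (length vs)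
     (\<lambda>(i, j). if (vs ! i, vs ! j) \<in> parcs G then 1 else 0)"

definition outdegree_matrix :: "'a pair_pre_digraph \<Rightarrow> 'a list \<Rightarrow> complex mat" where
  "outdegree_matrix G vs =
     mat_diag (length vs) (\<lambda>i. of_nat (out_degree (with_proj G) (vs ! i)))"

definition laplacian_matrix :: "'a pair_pre_digraph \<Rightarrow> 'a list \<Rightarrow> complex mat" where
  "laplacian_matrix G vs = outdegree_matrix G vs - adjacency_matrix G vs"

text \<open>The sum runs over the multiset of complex eigenvalues, each repeated according to its
  algebraic multiplicity. The eigenvalues need not be real, so the value has type
  \<^typ>\<open>complex\<close>; an inequality \<open>z \<le> complex_of_real b\<close> in the order of Complex_Order says that
  \<open>z\<close> is real and at most \<open>b\<close>.\<close>

definition laplacian_energy :: "'a pair_pre_digraph \<Rightarrow> 'a list \<Rightarrow> complex" where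
  "laplacian_energy G vs = (\<Sum>x\<in>#proots (char_poly (laplacian_matrix G vs)). x\<^sup>2)"

definition acyclic_digraph :: "('a, 'b) pre_digraph \<Rightarrow> bool" where
  "acyclic_digraph H \<longleftrightarrow> \<not> (\<exists>p. pre_digraph.cycle H p)"

definition dichromatic_number :: "'a pair_pre_digraph \<Rightarrow> nat" where
  "dichromatic_number G = (LEAST r. \<exists>P. partition_on (pverts G) P \<and> finite P \<and> card P = r \<and>
     (\<forall>X\<in>P. acyclic_digraph (with_proj G \<restriction> X)))"

definition join_digraph ::
    "'a pair_pre_digraph \<Rightarrow> 'a pair_pre_digraph \<Rightarrow> 'a pair_pre_digraph" where
  "join_digraph G H = \<lparr> pverts = pverts G \<union> pverts H,
     parcs = parcs G \<union> parcs H \<union>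
       (pverts G \<times> pverts H) \<union> (pverts H \<times> pverts G) \<rparr>"

text \<open>The join of a list of digraphs; the empty digraph is neutral for \<^const>\<open>join_digraph\<close>.\<close>

definition join_list :: "'a pair_pre_digraph list \<Rightarrow> 'a pair_pre_digraph" where
  "join_list Gs = foldr join_digraph Gs \<lparr> pverts = {}, parcs = {} \<rparr>"

definition transitive_tournament :: "'a pair_pre_digraph \<Rightarrow> bool" where
  "transitive_tournament T \<longleftrightarrow> pair_digraph T \<and>
     (\<forall>u\<in>pverts T. \<forall>v\<in>pverts T. u \<noteq> v \<longrightarrow> ((u, v) \<in> parcs T \<longleftrightarrow> (v, u) \<notin> parcs T)) \<and>
     (\<forall>u v w. (u, v) \<in> parcs T \<and> (v, w) \<in> parcs T \<longrightarrow> (u, w) \<in> parcs T)"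

text \<open>\<open>G = V\<^sup>1 \<or> \<dots> \<or> V\<^sup>r\<close> with pairwise vertex-disjoint transitive tournaments \<open>V\<^sup>i\<close>
  on \<open>m i\<close> vertices.\<close>

definition is_join_of_transitive_tournaments ::
    "'a pair_pre_digraph \<Rightarrow> nat \<Rightarrow> (nat \<Rightarrow> int) \<Rightarrow> bool" where
  "is_join_of_transitive_tournaments G r m \<longleftrightarrow>
     (\<exists>V :: nat \<Rightarrow> 'a pair_pre_digraph.
        disjoint_family_on (\<lambda>i. pverts (V i)) {1..r} \<and>
        (\<forall>i\<in>{1..r}. transitive_tournament (V i) \<and> int (card (pverts (V i))) = m i) \<and>
        G = join_list (map V [1..<Suc r]))"

end

theory Submission
  imports Defs "Jordan_Normal_Form.Schur_Decomposition"
begin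

text \<open>The sum of the squared eigenvalues is the trace of \<open>L\<^sup>2\<close>, hence equals the sum of
  \<open>d\<^sub>v\<^sup>2\<close> plus the number of mutual neighbours of \<open>v\<close>, over all vertices \<open>v\<close>. This quantity
  is strictly increasing in the arc set. Given a partition into \<open>r\<close> acyclic parts, a topological
  ordering of each part embeds \<open>G\<close> into a join of transitive tournaments with the same part
  sizes, so the energy is at most that of this join, with equality only for the join itself. The
  contribution of a part is a strictly concave function of its size, and therefore the balanced
  sizes are the unique maximisers.\<close>

subsection \<open>The trace of the squared Laplacian\<close>

lemma proots_prod_linear_factors:
  "proots (\<Prod>a\<leftarrow>as. [:- a, 1:]) = mset (as :: complex list)"
proof (induction as)
  case (Cons a as)
  have "(\<Prod>a\<leftarrow>as. [:- a, 1:]) \<noteq> (0 :: complex poly)"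
    by (auto simp: prod_list_zero_iff)
  then show ?case
    using Cons by (simp add: proots_mult del: mult_pCons_left)
qed simp

lemma trace_mult_eq:
  fixes A B :: "'b :: comm_semiring_0 mat"
  assumes "A \<in> carrier_mat n n" "B \<in> carrier_mat n n"
  shows "(\<Sum>i<n. (A * B) $$ (i, i)) = (\<Sum>i<n. \<Sum>j<n. A $$ (i, j) * B $$ (j, i))"
  using assms by (intro sum.cong) (auto simp: scalar_prod_def atLeast0LessThan)

lemma trace_mult_commute:
  fixes A B :: "'b :: comm_semiring_0 mat"
  assumes "A \<in> carrier_mat n n" "B \<in> carrier_mat n n"
  shows "(\<Sum>i<n. (A * B) $$ (i, i)) = (\<Sum>i<n. (B * A) $$ (i, i))"
  unfolding trace_mult_eq[OF assms] trace_mult_eq[OF assms(2,1)]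
  by (subst sum.swap) (simp add: mult.commute)

text \<open>Schur's decomposition writes \<open>A\<close> as \<open>P * B * Q\<close> with
  \<open>Q * P\<close> the identity and \<open>B\<close> upper triangular, its diagonal carrying the
  eigenvalues. Cyclicity of the trace turns the trace of \<open>A * A\<close> into that of
  \<open>B * B\<close>.\<close>

lemma sum_eigenvalues_squared:
  fixes A :: "complex mat"
  assumes A: "A \<in> carrier_mat n n"
  shows "(\<Sum>x\<in>#proots (char_poly A). x\<^sup>2) = (\<Sum>i<n. \<Sum>j<n. A $$ (i, j) * A $$ (j, i))"
proof -
  obtain as where as: "char_poly A = (\<Prod>a\<leftarrow>as. [:- a, 1:])"
    using char_poly_factorized[OF A] by blast
  obtain B P Q where schur: "schur_decomposition A as = (B, P, Q)"
    by (metis prod_cases3)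
  have sim: "similar_mat_wit A B P Q" and tri: "upper_triangular B" and diag: "diag_mat B = as"
    using schur_decomposition[OF A as schur] by auto
  note wit = similar_mat_witD2[OF A sim]
  have "A * A = P * B * (Q * P) * B * Q"
    unfolding wit(3) using wit(5-7) by (simp add: assoc_mult_mat[of _ n n _ n _ n])
  also have "\<dots> = P * (B * B * Q)"
    using wit by (simp add: assoc_mult_mat[of _ n n _ n _ n])
  finally have AA: "A * A = P * (B * B * Q)" .
  have "(\<Sum>i<n. (A * A) $$ (i, i)) = (\<Sum>i<n. (B * B * Q * P) $$ (i, i))"
    unfolding AA by (rule trace_mult_commute) (use wit in auto)
  also have "B * B * Q * P = B * B"
    using wit by (simp add: assoc_mult_mat[of _ n n _ n _ n])
  also have "(\<Sum>i<n. (B * B) $$ (i, i)) = (\<Sum>i<n. \<Sum>j<n. B $$ (i, j) * B $$ (j, i))"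
    by (rule trace_mult_eq) (use wit in auto)
  also have "\<dots> = (\<Sum>i<n. (B $$ (i, i))\<^sup>2)"
  proof (rule sum.cong[OF refl])
    fix i assume i: "i \<in> {..<n}"
    \<comment> \<open>For \<open>j\<close> other than \<open>i\<close>, one of the two entries lies
      below the diagonal of \<open>B\<close>, so only \<open>j = i\<close> survives.\<close>
    have "(\<Sum>j<n. B $$ (i, j) * B $$ (j, i)) = (\<Sum>j\<in>{i}. B $$ (i, j) * B $$ (j, i))"
    proof (rule sum.mono_neutral_right)
      show "\<forall>j\<in>{..<n} - {i}. B $$ (i, j) * B $$ (j, i) = 0"
      proof
        fix j assume j: "j \<in> {..<n} - {i}"
        then consider "j < i" | "i < j" by fastforce
        then show "B $$ (i, j) * B $$ (j, i) = 0"
          by cases (use upper_triangularD[OF tri] i j wit(5) in auto)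
      qed
    qed (use i in auto)
    then show "(\<Sum>j<n. B $$ (i, j) * B $$ (j, i)) = (B $$ (i, i))\<^sup>2"
      by (simp add: power2_eq_square)
  qed
  also have "\<dots> = (\<Sum>x\<leftarrow>as. x\<^sup>2)"
    using wit(5) unfolding diag[symmetric] diag_mat_def
    by (simp add: sum_list_sum_nth atLeast0LessThan)
  also have "\<dots> = (\<Sum>x\<in>#proots (char_poly A). x\<^sup>2)"
    unfolding as proots_prod_linear_factors
    by (simp add: sum_mset_sum_list flip: mset_map)
  finally show ?thesis
    unfolding trace_mult_eq[OF A A] by simp
qed

section \<open>The energy as a count over the arc relation\<close>

text \<open>For the arc set \<open>A\<close> of a loopless digraph on \<open>W\<close> this is the
  trace of the squared Laplacian. A bare relation as argument lets it apply equally to the join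
  containing the digraph.\<close>

definition walk_energy :: "'a set \<Rightarrow> 'a rel \<Rightarrow> nat" where
  "walk_energy W A = (\<Sum>v\<in>W. (card (A `` {v}))\<^sup>2 + card (A `` {v} \<inter> A\<inverse> `` {v}))"

text \<open>Passing from \<open>A\<close> to \<open>B\<close> enlarges the out-neighbourhood and the
  set of mutual neighbours of every vertex. If the totals agree, so do the terms at each vertex,
  hence the outdegrees, and an out-neighbourhood contained in another of the same finite size is
  equal to it.\<close>

lemma walk_energy_mono:
  assumes W: "finite W" and B: "B \<subseteq> W \<times> W" and AB: "A \<subseteq> B"
  shows "walk_energy W A \<le> walk_energy W B"
    and "walk_energy W A = walk_energy W B \<Longrightarrow> A = B"
proof -
  have fin: "finite (B `` {v})" for v
    using W B by (auto intro: finite_subset)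
  have out: "(card (A `` {v}))\<^sup>2 \<le> (card (B `` {v}))\<^sup>2" for v
    using fin AB by (intro power_mono card_mono) auto
  have mut: "card (A `` {v} \<inter> A\<inverse> `` {v}) \<le> card (B `` {v} \<inter> B\<inverse> `` {v})" for v
    using fin AB by (intro card_mono) auto
  show "walk_energy W A \<le> walk_energy W B"
    unfolding walk_energy_def by (intro sum_mono add_mono out mut)
  assume eq: "walk_energy W A = walk_energy W B"
  have "A `` {v} = B `` {v}" if v: "v \<in> W" for v
  proof -
    have "(card (A `` {v}))\<^sup>2 + card (A `` {v} \<inter> A\<inverse> `` {v}) =
        (card (B `` {v}))\<^sup>2 + card (B `` {v} \<inter> B\<inverse> `` {v})"
      by (rule sum_mono_inv[OF eq[unfolded walk_energy_def] _ v W])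
        (intro add_mono out mut)
    then have "(card (A `` {v}))\<^sup>2 = (card (B `` {v}))\<^sup>2"
      using out[of v] mut[of v] by linarith
    then have "card (A `` {v}) = card (B `` {v})"
      by simp
    then show ?thesis
      using fin AB by (intro card_subset_eq) auto
  qed
  then show "A = B"
    using AB B by blast
qed

text \<open>Off the diagonal, the product of two opposite entries of the Laplacian is
  \<open>1\<close> for a pair of mutual arcs and \<open>0\<close> otherwise; the diagonal
  contributes the squared outdegrees.\<close>

lemma laplacian_energy_eq_walk_energy:
  assumes G: "pair_digraph G" and vs: "distinct vs" "set vs = pverts G"
  shows "laplacian_energy G vs = of_nat (walk_energy (pverts G) (parcs G))"
proof -
  interpret pair_digraph G by fact
  let ?n = "length vs" and ?A = "parcs G" and ?L = "laplacian_matrix G vs"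
  have out: "out_degree (with_proj G) v = card (?A `` {v})" for v
  proof -
    have "out_arcs (with_proj G) v = Pair v ` (?A `` {v})"
      by (auto simp: out_arcs_def)
    then show ?thesis
      unfolding out_degree_def by (simp add: card_image inj_on_def)
  qed
  have L: "?L \<in> carrier_mat ?n ?n"
    unfolding laplacian_matrix_def adjacency_matrix_def by (rule minus_carrier_mat) simp
  have loopfree: "(v, v) \<notin> ?A" for v
    using pair_no_loops by fastforce
  have entry: "?L $$ (i, j) = (if i = j then of_nat (card (?A `` {vs ! i}))
      else - (if (vs ! i, vs ! j) \<in> ?A then 1 else 0))" if "i < ?n" "j < ?n" for i j
    using that loopfree
    by (auto simp: laplacian_matrix_def outdegree_matrix_def adjacency_matrix_def mat_diag_def out)
  have row: "(\<Sum>j<?n. ?L $$ (i, j) * ?L $$ (j, i)) = of_nat ((card (?A `` {vs ! i}))\<^sup>2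
      + card (?A `` {vs ! i} \<inter> ?A\<inverse> `` {vs ! i}))" if i: "i < ?n" for i
  proof -
    let ?v = "vs ! i"
    let ?S = "?A `` {?v} \<inter> ?A\<inverse> `` {?v}"
    have S: "?S \<subseteq> set vs"
      using vs wellformed' by auto
    \<comment> \<open>Absence of loops keeps \<open>vs ! i\<close> out of \<open>?S\<close>, so the
      indicator adds nothing at \<open>j = i\<close> and the two kinds of terms can be summed
      separately.\<close>
    have "(\<Sum>j<?n. ?L $$ (i, j) * ?L $$ (j, i)) =
      (\<Sum>j<?n. (if j = i then of_nat ((card (?A `` {?v}))\<^sup>2) else 0)
        + of_bool (vs ! j \<in> ?S))"
      using i loopfree by (intro sum.cong) (auto simp: entry power2_eq_square)
    also have "\<dots> = of_nat ((card (?A `` {?v}))\<^sup>2) + (\<Sum>j<?n. of_bool (vs ! j \<in> ?S))"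
      using i by (simp add: sum.distrib)
    also have "(\<Sum>j<?n. of_bool (vs ! j \<in> ?S)) = (\<Sum>v\<in>set vs. of_bool (v \<in> ?S) :: complex)"
      by (rule sum.reindex_bij_betw[OF bij_betw_nth]) (use vs in auto)
    also have "\<dots> = of_nat (card (set vs \<inter> ?S))"
      by (simp add: sum_of_bool_eq Int_def conj_commute)
    also have "set vs \<inter> ?S = ?S"
      using S by blast
    finally show ?thesis
      by simp
  qed
  have "laplacian_energy G vs = (\<Sum>i<?n. of_nat ((card (?A `` {vs ! i}))\<^sup>2
      + card (?A `` {vs ! i} \<inter> ?A\<inverse> `` {vs ! i})))"
    unfolding laplacian_energy_def sum_eigenvalues_squared[OF L] using row by simp
  also have "\<dots> = (\<Sum>v\<in>set vs. of_nat ((card (?A `` {v}))\<^sup>2 + card (?A `` {v} \<inter> ?A\<inverse> `` {v})))"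
    by (rule sum.reindex_bij_betw[OF bij_betw_nth]) (use vs in auto)
  finally show ?thesis
    by (simp add: walk_energy_def vs)
qed

subsection \<open>Joins of transitive tournaments\<close>

text \<open>Arcs inside a part descend in rank, so ranking each part by \<open>0, 1, ...\<close>
  makes \<open>h v\<close> the number of out-neighbours of \<open>v\<close> within its own part.
  Distinct parts are joined in both directions.\<close>

definition tournament_join :: "'i set \<Rightarrow> ('i \<Rightarrow> 'a set) \<Rightarrow> ('a \<Rightarrow> nat) \<Rightarrow> 'a rel" where
  "tournament_join I X h =
     {(u, v). \<exists>i\<in>I. \<exists>j\<in>I. u \<in> X i \<and> v \<in> X j \<and> (i = j \<longrightarrow> h v < h u)}"

lemma tournament_join_alt:
  "tournament_join I X h = (\<Union>i\<in>I. {(u, v). u \<in> X i \<and> v \<in> X i \<and> h v < h u}) \<union>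
    {(u, v). \<exists>i\<in>I. \<exists>j\<in>I. i \<noteq> j \<and> u \<in> X i \<and> v \<in> X j}"
  unfolding tournament_join_def by (intro equalityI subrelI) (simp, metis)+

text \<open>The contribution of a part of \<open>m\<close> vertices to the energy of a join on
  \<open>n\<close> vertices, in closed form. As a real polynomial it avoids truncated subtraction
  and admits the factorisation behind its concavity.\<close>

definition block_energy :: "nat \<Rightarrow> nat \<Rightarrow> real" where
  "block_energy n m = (real n)\<^sup>2 * m - n * (real m)\<^sup>2 + (real m) ^ 3 / 3 - (real m)\<^sup>2 / 2 + m / 6"

lemma block_energy_eq_sum:
  assumes "m \<le> n"
  shows "real (\<Sum>k<m. (n - m + k)\<^sup>2 + (n - m)) = block_energy n m"
proof -
  \<comment> \<open>The offset \<open>n - m\<close> is replaced by a free \<open>a\<close>, which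
    stays fixed while \<open>m\<close> grows in the induction.\<close>
  have "real (\<Sum>k<m. (a + k)\<^sup>2 + a) = m * (real a)\<^sup>2 + a * real m * (real m - 1)
      + (real m - 1) * m * (2 * real m - 1) / 6 + real m * a" for a
    by (induction m) (simp_all add: field_simps power2_eq_square)
  from this[of "n - m"] show ?thesis
    using assms by (simp add: block_energy_def of_nat_diff field_simps power2_eq_square power3_eq_cube)
qed

lemma card_less_rank:
  assumes "bij_betw h S {..<m}" "k < m"
  shows "card {u \<in> S. h u < k} = k"
proof -
  have "bij_betw h {u \<in> S. h u < k} {..<k}"
    using assms by (auto simp: bij_betw_def inj_on_def image_iff set_eq_iff) (metis order.strict_trans)+
  then show ?thesis
    using bij_betw_same_card by fastforce
qed

text \<open>A vertex \<open>v\<close> of \<open>X i\<close> sends arcs to all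
  \<open>n - card (X i)\<close> vertices outside its part and to the \<open>h v\<close> vertices
  ranked below it; its mutual neighbours are the outside vertices. Within a part the ranks run from
  \<open>0\<close> to \<open>card (X i) - 1\<close>.\<close>

lemma walk_energy_tournament_join:
  assumes I: "finite I" and disj: "disjoint_family_on X I"
    and X: "\<And>i. i \<in> I \<Longrightarrow> finite (X i)"
    and h: "\<And>i. i \<in> I \<Longrightarrow> bij_betw h (X i) {..<card (X i)}"
    and n: "n = card (\<Union>i\<in>I. X i)"
  shows "real (walk_energy (\<Union>i\<in>I. X i) (tournament_join I X h)) = (\<Sum>i\<in>I. block_energy n (card (X i)))"
proof -
  let ?W = "\<Union>i\<in>I. X i" and ?M = "tournament_join I X h"
  have W: "finite ?W"
    using I X by blast
  have same: "i = j" if "i \<in> I" "j \<in> I" "v \<in> X i" "v \<in> X j" for i j v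
    using disj that by (auto simp: disjoint_family_on_def)
  have vertex: "(card (?M `` {v}))\<^sup>2 + card (?M `` {v} \<inter> ?M\<inverse> `` {v})
      = (n - card (X i) + h v)\<^sup>2 + (n - card (X i))" if i: "i \<in> I" and v: "v \<in> X i" for i v
  proof -
    have co: "card (?W - X i) = n - card (X i)"
      unfolding n using i X by (intro card_Diff_subset) auto
    \<comment> \<open>By disjointness \<open>X i\<close> is the only part containing
      \<open>v\<close>, so an existential over the parts of \<open>v\<close> collapses to the index
      \<open>i\<close>.\<close>
    have at: "(\<exists>k\<in>I. v \<in> X k \<and> Q k) \<longleftrightarrow> Q i" for Q
      using i v same by blast
    have "u \<in> ?M `` {v} \<longleftrightarrow> (\<exists>j\<in>I. u \<in> X j \<and> (i = j \<longrightarrow> h u < h v))" for u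
      using at[of "\<lambda>k. \<exists>j\<in>I. u \<in> X j \<and> (k = j \<longrightarrow> h u < h v)"]
      by (simp add: tournament_join_def)
    then have out: "?M `` {v} = (?W - X i) \<union> {u \<in> X i. h u < h v}"
      using i same by blast
    have "u \<in> ?M\<inverse> `` {v} \<longleftrightarrow> (\<exists>j\<in>I. u \<in> X j \<and> (j = i \<longrightarrow> h v < h u))" for u
      using at[of "\<lambda>k. \<exists>j\<in>I. u \<in> X j \<and> (j = k \<longrightarrow> h v < h u)"]
      by (simp add: tournament_join_def) blast
    then have inn: "?M\<inverse> `` {v} = (?W - X i) \<union> {u \<in> X i. h v < h u}"
      using i same by blast
    have "h v < card (X i)"
      using h[OF i] v by (auto simp: bij_betw_def)
    then have "card {u \<in> X i. h u < h v} = h v"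
      by (rule card_less_rank[OF h[OF i]])
    then have "card (?M `` {v}) = n - card (X i) + h v"
      unfolding out co[symmetric] using W X[OF i] by (subst card_Un_disjoint) auto
    moreover have "?M `` {v} \<inter> ?M\<inverse> `` {v} = ?W - X i"
      unfolding out inn by auto
    ultimately show ?thesis
      using co by simp
  qed
  have "walk_energy ?W ?M = (\<Sum>i\<in>I. \<Sum>v\<in>X i. (card (?M `` {v}))\<^sup>2 + card (?M `` {v} \<inter> ?M\<inverse> `` {v}))"
    unfolding walk_energy_def
    by (rule sum.UNION_disjoint) (use I X disj in \<open>auto simp: disjoint_family_on_def\<close>)
  also have "\<dots> = (\<Sum>i\<in>I. \<Sum>v\<in>X i. (n - card (X i) + h v)\<^sup>2 + (n - card (X i)))"
    using vertex by simp
  also have "\<dots> = (\<Sum>i\<in>I. \<Sum>k<card (X i). (n - card (X i) + k)\<^sup>2 + (n - card (X i)))"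
    by (intro sum.cong refl sum.reindex_bij_betw h)
  finally have "real (walk_energy ?W ?M)
      = (\<Sum>i\<in>I. real (\<Sum>k<card (X i). (n - card (X i) + k)\<^sup>2 + (n - card (X i))))"
    by simp
  also have "\<dots> = (\<Sum>i\<in>I. block_energy n (card (X i)))"
  proof (intro sum.cong refl block_energy_eq_sum)
    show "card (X i) \<le> n" if "i \<in> I" for i
      unfolding n using W that by (intro card_mono) auto
  qed
  finally show ?thesis .
qed

subsection \<open>Balanced part sizes\<close>

text \<open>Concavity on the integers: the graph lies below the line through \<open>f\<close> and \<open>f + 1\<close>. A single
  line of this kind covers both the divisible and the non-divisible case.\<close>

lemma block_energy_chord:
  assumes "m \<le> n" "f \<le> n"
  defines "chord \<equiv> block_energy n f
    + (real m - real f) * (block_energy n (f + 1) - block_energy n f)"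
  shows "block_energy n m \<le> chord" and "block_energy n m = chord \<longleftrightarrow> m = f \<or> m = f + 1"
proof -
  \<comment> \<open>The cubic \<open>chord - block_energy n m\<close> vanishes at
    \<open>m = f\<close> and \<open>m = f + 1\<close>, and \<open>?c / 3\<close> is the remaining
    linear factor. The summand \<open>1 / 2\<close> keeps it positive even for
    \<open>m = f = n\<close>; the other two factors are consecutive integers, so their product is
    never negative.\<close>
  let ?c = "3 * real n + 1 / 2 - 2 * real f - real m"
  have diff: "chord - block_energy n m = (real m - f) * (real m - f - 1) * ?c / 3"
    unfolding chord_def block_energy_def
    by (simp add: field_simps power2_eq_square power3_eq_cube)
  have c: "?c > 0"
    using assms(1,2) by linarith
  have "(real m - f) * (real m - f - 1) \<ge> 0"
  proof (cases "m \<le> f")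
    case True
    then show ?thesis by (intro mult_nonpos_nonpos) auto
  next
    case False
    then show ?thesis by (intro mult_nonneg_nonneg) auto
  qed
  with c have "chord - block_energy n m \<ge> 0"
    unfolding diff by simp
  then show "block_energy n m \<le> chord" by simp
  have "block_energy n m = chord \<longleftrightarrow> (real m - f) * (real m - f - 1) * ?c / 3 = 0"
    unfolding diff[symmetric] by auto
  also have "\<dots> \<longleftrightarrow> m = f \<or> m = f + 1"
    using c by auto
  finally show "block_energy n m = chord \<longleftrightarrow> m = f \<or> m = f + 1" .
qed

text \<open>For \<open>r > 0\<close>, the total for \<open>n mod r\<close> parts of size
  \<open>n div r + 1\<close> and the others of size \<open>n div r\<close>, written as a sum of
  chord values.\<close>

definition balanced_energy :: "nat \<Rightarrow> nat \<Rightarrow> real" where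
  "balanced_energy n r = (let f = n div r in
     r * block_energy n f + real (n mod r) * (block_energy n (f + 1) - block_energy n f))"

text \<open>The chord is affine in the part size, so its sum depends only on the number of parts and
  on their total size \<open>n\<close>. The bound follows summand by summand, and equal sums force
  each size to be one where the chord meets the graph.\<close>

lemma sum_block_energy_le:
  assumes I: "finite I" and n: "(\<Sum>i\<in>I. m i) = n"
  shows "(\<Sum>i\<in>I. block_energy n (m i)) \<le> balanced_energy n (card I)"
    and "(\<Sum>i\<in>I. block_energy n (m i)) = balanced_energy n (card I)
      \<longleftrightarrow> (\<forall>i\<in>I. m i = n div card I \<or> m i = n div card I + 1)"
proof -
  let ?f = "n div card I"
  let ?chord = "\<lambda>k. block_energy n ?f
    + (real k - real ?f) * (block_energy n (?f + 1) - block_energy n ?f)"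
  have f: "?f \<le> n" by simp
  have m: "m i \<le> n" if "i \<in> I" for i
    unfolding n[symmetric] using I that by (simp add: member_le_sum)
  have "(\<Sum>i\<in>I. ?chord (m i)) = card I * block_energy n ?f
      + (real n - card I * ?f) * (block_energy n (?f + 1) - block_energy n ?f)"
    by (simp add: sum.distrib sum_subtractf flip: sum_distrib_right n)
  also have "real n - card I * ?f = n mod card I"
    by (simp add: minus_mult_div_eq_mod flip: of_nat_mult of_nat_diff)
  finally have total: "(\<Sum>i\<in>I. ?chord (m i)) = balanced_energy n (card I)"
    by (simp add: balanced_energy_def Let_def)
  show "(\<Sum>i\<in>I. block_energy n (m i)) \<le> balanced_energy n (card I)"
    unfolding total[symmetric] by (intro sum_mono block_energy_chord m f)
  show "(\<Sum>i\<in>I. block_energy n (m i)) = balanced_energy n (card I)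
      \<longleftrightarrow> (\<forall>i\<in>I. m i = ?f \<or> m i = ?f + 1)"
  proof
    assume "(\<Sum>i\<in>I. block_energy n (m i)) = balanced_energy n (card I)"
    then have eq: "(\<Sum>i\<in>I. block_energy n (m i)) = (\<Sum>i\<in>I. ?chord (m i))"
      unfolding total .
    show "\<forall>i\<in>I. m i = ?f \<or> m i = ?f + 1"
    proof
      fix i assume i: "i \<in> I"
      have "block_energy n (m i) = ?chord (m i)"
        by (rule sum_mono_inv[OF eq _ i I]) (intro block_energy_chord m f)
      then show "m i = ?f \<or> m i = ?f + 1"
        using block_energy_chord(2)[OF m[OF i] f] by simp
    qed
  next
    assume "\<forall>i\<in>I. m i = ?f \<or> m i = ?f + 1"
    then show "(\<Sum>i\<in>I. block_energy n (m i)) = balanced_energy n (card I)"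
      unfolding total[symmetric] using block_energy_chord(2)[OF m f] by (intro sum.cong) auto
  qed
qed

subsection \<open>Acyclic parts\<close>

text \<open>A topological ordering, built by removing sources. Arcs have to descend in rank, so the
  removed source receives the largest rank.\<close>

lemma acyclic_ranking:
  assumes "finite S" "acyclic (A \<inter> S \<times> S)"
  obtains h where "bij_betw h S {..<card S}"
    and "\<And>u v. (u, v) \<in> A \<Longrightarrow> u \<in> S \<Longrightarrow> v \<in> S \<Longrightarrow> h v < h u"
proof -
  have "\<exists>h. bij_betw h S {..<card S} \<and> (\<forall>u\<in>S. \<forall>v\<in>S. (u, v) \<in> A \<longrightarrow> h v < (h u :: nat))"
    using assms
  proof (induction "card S" arbitrary: S)
    case 0
    then show ?case by (auto simp: bij_betw_def)
  next
    case (Suc k)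
    have "finite (A \<inter> S \<times> S)"
      using Suc.prems by blast
    then have wf: "wf (A \<inter> S \<times> S)"
      using Suc.prems finite_acyclic_wf by blast
    have "S \<noteq> {}" using Suc.hyps by auto
    \<comment> \<open>An element of \<open>S\<close> that is minimal for the well-founded arc
      relation has no incoming arc from \<open>S\<close>.\<close>
    then obtain s where s: "s \<in> S" and source: "\<And>u. u \<in> S \<Longrightarrow> (u, s) \<notin> A"
      using wfE_min'[OF wf] by (metis IntI SigmaI)
    let ?S = "S - {s}"
    have k: "k = card ?S"
      using Suc.hyps s Suc.prems by simp
    have "acyclic (A \<inter> ?S \<times> ?S)"
      by (rule acyclic_subset[OF Suc.prems(2)]) auto
    then obtain h where h: "bij_betw h ?S {..<k}"
      and arcs: "\<forall>u\<in>?S. \<forall>v\<in>?S. (u, v) \<in> A \<longrightarrow> h v < h u"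
      using Suc.hyps(1)[OF k] Suc.prems k by auto
    let ?h = "h(s := k)"
    have "bij_betw ?h ?S {..<k}"
      using h by (subst bij_betw_cong[of _ _ h]) auto
    then have "bij_betw ?h (insert s ?S) (insert k {..<k})"
      using notIn_Un_bij_betw3[of s ?S ?h "{..<k}"] by auto
    then have "bij_betw ?h S {..<card S}"
      using s Suc.hyps(2) by (simp add: insert_absorb lessThan_Suc flip: Suc.hyps(2))
    moreover have "?h v < ?h u" if "u \<in> S" "v \<in> S" "(u, v) \<in> A" for u v
    proof -
      have "v \<noteq> s" using source that by blast
      moreover have "h v < k" if "v \<in> ?S" using h that by (auto simp: bij_betw_def)
      ultimately show ?thesis using arcs that by auto
    qed
    ultimately show ?case by blast
  qed
  then show ?thesis using that by blast
qed

text \<open>The rankings of the parts are glued into one function; by disjointness, the part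
  containing a vertex tells which ranking to apply.\<close>

lemma common_ranking:
  fixes X :: "'i \<Rightarrow> 'a set"
  assumes disj: "disjoint_family_on X I"
    and X: "\<And>i. i \<in> I \<Longrightarrow> finite (X i)"
    and acyc: "\<And>i. i \<in> I \<Longrightarrow> acyclic (A \<inter> X i \<times> X i)"
  shows "\<exists>h :: 'a \<Rightarrow> nat. \<forall>i\<in>I. bij_betw h (X i) {..<card (X i)} \<and>
    (\<forall>u\<in>X i. \<forall>v\<in>X i. (u, v) \<in> A \<longrightarrow> h v < h u)"
proof -
  have "\<forall>i\<in>I. \<exists>h. bij_betw h (X i) {..<card (X i)} \<and>
      (\<forall>u v. (u, v) \<in> A \<longrightarrow> u \<in> X i \<longrightarrow> v \<in> X i \<longrightarrow> h v < h u)"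
    using X acyc acyclic_ranking by metis
  then obtain H where H: "\<And>i. i \<in> I \<Longrightarrow> bij_betw (H i) (X i) {..<card (X i)}"
    "\<And>i u v. i \<in> I \<Longrightarrow> (u, v) \<in> A \<Longrightarrow> u \<in> X i \<Longrightarrow> v \<in> X i \<Longrightarrow> H i v < H i u"
    by metis
  define h where "h v = H (THE i. i \<in> I \<and> v \<in> X i) v" for v
  have h: "h v = H i v" if "i \<in> I" "v \<in> X i" for i v
  proof -
    have "(THE i. i \<in> I \<and> v \<in> X i) = i"
      using disj that by (intro the_equality) (auto simp: disjoint_family_on_def)
    then show ?thesis by (simp add: h_def)
  qed
  have "bij_betw h (X i) {..<card (X i)}" if "i \<in> I" for i
    using H(1)[OF that] h that by (subst bij_betw_cong[of _ _ "H i"]) auto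
  moreover have "h v < h u" if "i \<in> I" "u \<in> X i" "v \<in> X i" "(u, v) \<in> A" for i u v
    using H(2) h that by simp
  ultimately show ?thesis
    by blast
qed

text \<open>The bridge from cycles as arc walks to acyclicity of the arc relation: a pair
  \<open>(v, v)\<close> in the transitive closure gives a nonempty closed walk, and such a walk
  yields a cycle.\<close>

lemma acyclic_digraph_imp_acyclic:
  assumes "pair_digraph G" and "acyclic_digraph (with_proj G \<restriction> S)"
  shows "acyclic (parcs G \<inter> S \<times> S)"
proof (rule acyclicI, intro allI notI)
  interpret pair_digraph G by fact
  let ?H = "with_proj G \<restriction> S"
  interpret H: wf_digraph ?H
    by (rule wellformed_induce_subgraph)
  have "arcs_ends ?H = parcs G \<inter> S \<times> S"
    by (auto simp: arcs_ends_conv)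
  moreover fix v assume "(v, v) \<in> (parcs G \<inter> S \<times> S)\<^sup>+"
  ultimately obtain p where "H.awalk v p v" "p \<noteq> []"
    using H.reachable1_awalk by metis
  then have "H.closed_w p"
    by (auto simp: H.closed_w_def)
  then show False
    using H.closed_w_imp_cycle[of p] assms(2) unfolding acyclic_digraph_def by blast
qed

lemma acyclic_digraph_singleton:
  assumes "pair_digraph G"
  shows "acyclic_digraph (with_proj G \<restriction> {v})"
proof -
  interpret pair_digraph G by fact
  have "(v, v) \<notin> parcs G"
    using pair_no_loops[of "(v, v)"] by auto
  then have "arcs (with_proj G \<restriction> {v}) = {}"
    by (auto simp: induce_subgraph_arcs)
  moreover have "set p \<subseteq> arcs (with_proj G \<restriction> {v}) \<and> p \<noteq> []"
    if "pre_digraph.cycle (with_proj G \<restriction> {v}) p" for p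
    using that unfolding pre_digraph.cycle_def pre_digraph.awalk_def by blast
  ultimately show ?thesis
    unfolding acyclic_digraph_def by (metis set_empty subset_empty)
qed

text \<open>The minimum in \<open>dichromatic_number\<close> is known to be attained once some
  admissible partition exists; the partition into singletons is one, as there are no loops.\<close>

lemma dichromatic_partition:
  assumes "pair_digraph G"
  obtains P where "partition_on (pverts G) P" "finite P" "card P = dichromatic_number G"
    "\<And>S. S \<in> P \<Longrightarrow> acyclic (parcs G \<inter> S \<times> S)"
proof -
  interpret pair_digraph G by fact
  let ?Q = "\<lambda>r P. partition_on (pverts G) P \<and> finite P \<and> card P = r \<and>
     (\<forall>S\<in>P. acyclic_digraph (with_proj G \<restriction> S))"
  let ?P = "(\<lambda>v. {v}) ` pverts G"
  have "partition_on (pverts G) ?P"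
    by (auto simp: partition_on_def disjoint_def)
  then have "?Q (card ?P) ?P"
    using pair_finite_verts acyclic_digraph_singleton[OF assms] by auto
  then have "\<exists>P. ?Q (card ?P) P"
    by (rule exI)
  then have "\<exists>P. ?Q (dichromatic_number G) P"
    unfolding dichromatic_number_def by (rule LeastI)
  then obtain P where "?Q (dichromatic_number G) P"
    by (elim exE)
  then show ?thesis
    using acyclic_digraph_imp_acyclic[OF assms] by (intro that[of P]) simp_all
qed

subsection \<open>The extremal digraphs\<close>

lemma pverts_join_list: "pverts (join_list Gs) = (\<Union>G\<in>set Gs. pverts G)"
  by (induction Gs) (auto simp: join_list_def join_digraph_def)

text \<open>A repeated index would make the join add all pairs inside one vertex set, which the
  condition \<open>i \<noteq> j\<close> does not describe; hence \<open>distinct is\<close>.\<close>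

lemma parcs_join_list_map:
  assumes "distinct is"
  shows "parcs (join_list (map V is)) = (\<Union>i\<in>set is. parcs (V i)) \<union>
    {(u, v). \<exists>i\<in>set is. \<exists>j\<in>set is. i \<noteq> j \<and> u \<in> pverts (V i) \<and> v \<in> pverts (V j)}"
  using assms
proof (induction "is")
  case Nil
  then show ?case by (simp add: join_list_def)
next
  case (Cons k ks)
  have "parcs (join_list (map V (k # ks))) = parcs (V k) \<union> parcs (join_list (map V ks))
      \<union> pverts (V k) \<times> pverts (join_list (map V ks)) \<union> pverts (join_list (map V ks)) \<times> pverts (V k)"
    by (simp add: join_list_def join_digraph_def)
  then show ?case
    using Cons unfolding pverts_join_list by auto
qed

lemma transitive_tournament_acyclic:
  assumes "transitive_tournament T"
  shows "acyclic (parcs T)"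
proof -
  interpret pair_digraph T
    using assms by (simp add: transitive_tournament_def)
  have "trans (parcs T)"
    using assms unfolding transitive_tournament_def by (blast intro: transI)
  then show ?thesis
    using pair_no_loops by (fastforce simp: acyclic_def)
qed

text \<open>A transitive tournament is the descending order of a ranking of its vertices. This
  identifies the extremal digraphs with the relation whose energy is already computed.\<close>

lemma is_join_iff_tournament_join:
  "is_join_of_transitive_tournaments G r m \<longleftrightarrow>
    (\<exists>X h. disjoint_family_on X {1..r} \<and>
      (\<forall>i\<in>{1..r}. finite (X i) \<and> bij_betw h (X i) {..<card (X i)} \<and> int (card (X i)) = m i) \<and>
      pverts G = (\<Union>i\<in>{1..r}. X i) \<and> parcs G = tournament_join {1..r} X h)"
  (is "_ \<longleftrightarrow> (\<exists>X h. ?R X h)")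
proof
  assume "is_join_of_transitive_tournaments G r m"
  then obtain V where disj: "disjoint_family_on (\<lambda>i. pverts (V i)) {1..r}"
    and tt: "\<And>i. i \<in> {1..r} \<Longrightarrow> transitive_tournament (V i)"
    and card: "\<And>i. i \<in> {1..r} \<Longrightarrow> int (card (pverts (V i))) = m i"
    and G: "G = join_list (map V [1..<Suc r])"
    unfolding is_join_of_transitive_tournaments_def by blast
  let ?X = "\<lambda>i. pverts (V i)"
  have dig: "pair_digraph (V i)" if "i \<in> {1..r}" for i
    using tt[OF that] by (simp add: transitive_tournament_def)
  have set_is: "set [1..<Suc r] = {1..r}"
    by auto
  have verts: "pverts G = (\<Union>i\<in>{1..r}. ?X i)"
    unfolding G pverts_join_list set_map set_is by simp
  have arcs: "parcs G = (\<Union>i\<in>{1..r}. parcs (V i)) \<union>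
      {(u, v). \<exists>i\<in>{1..r}. \<exists>j\<in>{1..r}. i \<noteq> j \<and> u \<in> ?X i \<and> v \<in> ?X j}"
    unfolding G using parcs_join_list_map[of "[1..<Suc r]" V] unfolding set_is by simp
  have same: "i = j" if "i \<in> {1..r}" "j \<in> {1..r}" "v \<in> ?X i" "v \<in> ?X j" for i j v
    using disj that unfolding disjoint_family_on_def by blast
  have ends: "u \<in> ?X i \<and> v \<in> ?X i" if "i \<in> {1..r}" "(u, v) \<in> parcs (V i)" for i u v
  proof -
    interpret pair_digraph "V i" by (rule dig) fact
    show ?thesis using wellformed' that by blast
  qed
  \<comment> \<open>No arc added by the join has both ends in one part, so restricting
    \<open>parcs G\<close> to a part recovers its tournament, and a common ranking for
    \<open>G\<close> ranks every tournament.\<close>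
  have inside: "parcs G \<inter> ?X i \<times> ?X i = parcs (V i)" if "i \<in> {1..r}" for i
  proof (intro equalityI subrelI)
    fix u v assume "(u, v) \<in> parcs G \<inter> ?X i \<times> ?X i"
    then have uv: "(u, v) \<in> parcs G" "u \<in> ?X i" "v \<in> ?X i"
      by auto
    from uv(1) consider
        k where "k \<in> {1..r}" "(u, v) \<in> parcs (V k)"
      | k l where "k \<in> {1..r}" "l \<in> {1..r}" "k \<noteq> l" "u \<in> ?X k" "v \<in> ?X l"
      unfolding arcs by blast
    then show "(u, v) \<in> parcs (V i)"
    proof cases
      case (1 k)
      then show ?thesis
        using ends[OF 1] same[OF 1(1) that _ uv(2)] by simp
    next
      case (2 k l)
      then show ?thesis
        using same[OF 2(1) that 2(4) uv(2)] same[OF 2(2) that 2(5) uv(3)] by simp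
    qed
  next
    fix u v assume "(u, v) \<in> parcs (V i)"
    then show "(u, v) \<in> parcs G \<inter> ?X i \<times> ?X i"
      unfolding arcs using ends that by blast
  qed
  have fin: "finite (?X i)" if "i \<in> {1..r}" for i
    using dig[OF that] pair_fin_digraph.pair_finite_verts pair_digraph.axioms(1) by blast
  have acyc: "acyclic (parcs G \<inter> ?X i \<times> ?X i)" if "i \<in> {1..r}" for i
    unfolding inside[OF that] by (rule transitive_tournament_acyclic[OF tt[OF that]])
  obtain h where h: "\<And>i. i \<in> {1..r} \<Longrightarrow> bij_betw h (?X i) {..<card (?X i)}"
    and desc: "\<And>i u v. i \<in> {1..r} \<Longrightarrow> (u, v) \<in> parcs G \<Longrightarrow> u \<in> ?X i \<Longrightarrow> v \<in> ?X i \<Longrightarrow> h v < h u"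
    using common_ranking[OF disj fin acyc] by blast
  have total: "(u, v) \<in> parcs (V i) \<longleftrightarrow> (v, u) \<notin> parcs (V i)"
    if "i \<in> {1..r}" "u \<in> ?X i" "v \<in> ?X i" "u \<noteq> v" for i u v
    using tt[OF that(1)] that(2-4) unfolding transitive_tournament_def by blast
  \<comment> \<open>Arcs descend by the choice of \<open>h\<close>. Conversely, if a descending pair
    were not an arc, totality would make its reverse an arc, and that arc would ascend.\<close>
  have arc_iff: "(u, v) \<in> parcs (V i) \<longleftrightarrow> h v < h u" if i: "i \<in> {1..r}" "u \<in> ?X i" "v \<in> ?X i" for i u v
  proof
    assume "(u, v) \<in> parcs (V i)"
    then show "h v < h u"
      using desc i inside by blast
  next
    assume less: "h v < h u"
    have "(v, u) \<notin> parcs (V i)"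
    proof
      assume "(v, u) \<in> parcs (V i)"
      then have "(v, u) \<in> parcs G"
        using inside[OF i(1)] by blast
      then have "h u < h v"
        using desc i by blast
      with less show False
        by simp
    qed
    moreover have "u \<noteq> v"
      using less by blast
    ultimately show "(u, v) \<in> parcs (V i)"
      using total[OF i] by blast
  qed
  have arcs_V: "parcs (V i) = {(u, v). u \<in> ?X i \<and> v \<in> ?X i \<and> h v < h u}" if "i \<in> {1..r}" for i
  proof (intro equalityI subrelI)
    fix u v assume uv: "(u, v) \<in> parcs (V i)"
    then have "u \<in> ?X i" "v \<in> ?X i"
      using ends[OF that] by blast+
    with uv show "(u, v) \<in> {(u, v). u \<in> ?X i \<and> v \<in> ?X i \<and> h v < h u}"
      using arc_iff[OF that] by simp
  next
    fix u v assume "(u, v) \<in> {(u, v). u \<in> ?X i \<and> v \<in> ?X i \<and> h v < h u}"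
    then show "(u, v) \<in> parcs (V i)"
      using arc_iff[OF that] by simp
  qed
  have "(\<Union>i\<in>{1..r}. parcs (V i)) =
      (\<Union>i\<in>{1..r}. {(u, v). u \<in> ?X i \<and> v \<in> ?X i \<and> h v < h u})"
    by (rule SUP_cong[OF refl arcs_V])
  then have model: "parcs G = tournament_join {1..r} ?X h"
    unfolding arcs tournament_join_alt by simp
  have "?R ?X h"
    using disj verts model
  proof (intro conjI ballI)
    fix i assume i: "i \<in> {1..r}"
    show "finite (?X i)" "bij_betw h (?X i) {..<card (?X i)}" "int (card (?X i)) = m i"
      using fin[OF i] h[OF i] card[OF i] by simp_all
  qed
  then show "\<exists>X h. ?R X h"
    by blast
next
  assume "\<exists>X h. ?R X h"
  then obtain X h where R: "?R X h"
    by blast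
  define V where "V i = \<lparr>pverts = X i, parcs = {(u, v). u \<in> X i \<and> v \<in> X i \<and> h v < h u}\<rparr>" for i
  have set_is: "set [1..<Suc r] = {1..r}"
    by auto
  have tt: "transitive_tournament (V i)" if "i \<in> {1..r}" for i
  proof -
    have fin: "finite (X i)" and inj: "inj_on h (X i)"
      using R that by (auto simp: bij_betw_def)
    have "finite {(u, v). u \<in> X i \<and> v \<in> X i \<and> h v < h u}"
      by (rule finite_subset[of _ "X i \<times> X i"]) (use fin in auto)
    then have dig: "pair_digraph (V i)"
      by unfold_locales (use fin in \<open>auto simp: V_def\<close>)
    show ?thesis
      unfolding transitive_tournament_def
    proof (intro conjI ballI allI impI dig)
      fix u v assume uv: "u \<in> pverts (V i)" "v \<in> pverts (V i)" "u \<noteq> v"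
      \<comment> \<open>Injectivity of \<open>h\<close> on the part is what makes exactly one of the
        two orientations descend.\<close>
      then have "h u \<noteq> h v"
        using inj_onD[OF inj, of u v] by (auto simp: V_def)
      then have "h v < h u \<longleftrightarrow> \<not> h u < h v"
        by linarith
      then show "(u, v) \<in> parcs (V i) \<longleftrightarrow> (v, u) \<notin> parcs (V i)"
        using uv by (simp add: V_def)
    next
      fix u v w assume "(u, v) \<in> parcs (V i) \<and> (v, w) \<in> parcs (V i)"
      then show "(u, w) \<in> parcs (V i)"
        by (simp add: V_def)
    qed
  qed
  have "pverts G = pverts (join_list (map V [1..<Suc r]))"
    unfolding pverts_join_list set_map set_is using R by (simp add: V_def)
  moreover have "parcs G = parcs (join_list (map V [1..<Suc r]))"
  proof -
    have "parcs (join_list (map V [1..<Suc r])) = tournament_join {1..r} X h"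
      unfolding parcs_join_list_map[OF distinct_upt] set_is tournament_join_alt
      by (simp add: V_def)
    then show ?thesis using R by simp
  qed
  ultimately have "G = join_list (map V [1..<Suc r])"
    by (simp add: pair_pre_digraph.equality)
  moreover have "pverts (V i) = X i" for i
    by (simp add: V_def)
  moreover have "int (card (X i)) = m i" if "i \<in> {1..r}" for i
    using R that by blast
  ultimately show "is_join_of_transitive_tournaments G r m"
    unfolding is_join_of_transitive_tournaments_def
    using R tt by (intro exI[of _ V] conjI ballI) simp_all
qed

section \<open>Ordering the parts by size\<close>

lemma tournament_join_reindex:
  assumes "bij_betw g I J"
  shows "tournament_join I (X \<circ> g) h = tournament_join J X h"
proof -
  have inj: "g i = g j \<longleftrightarrow> i = j" if "i \<in> I" "j \<in> I" for i j
    using inj_on_eq_iff[OF bij_betw_imp_inj_on[OF assms] that] .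
  have J: "J = g ` I"
    using assms by (simp add: bij_betw_def)
  have "(\<exists>i\<in>I. \<exists>j\<in>I. u \<in> X (g i) \<and> v \<in> X (g j) \<and> (g i = g j \<longrightarrow> h v < h u)) \<longleftrightarrow>
      (\<exists>i\<in>I. \<exists>j\<in>I. u \<in> X (g i) \<and> v \<in> X (g j) \<and> (i = j \<longrightarrow> h v < h u))" for u v
    by (intro bex_cong refl conj_cong) (simp add: inj)
  then show ?thesis
    by (simp add: tournament_join_def J)
qed

text \<open>Writing each size as \<open>f\<close> plus an indicator shows that exactly
  \<open>k\<close> sizes equal \<open>f + 1\<close>. Mapping \<open>{1..k}\<close> onto their
  indices and the remaining indices onto the rest lists the larger parts first, as the extremal
  digraphs are described.\<close>

lemma balanced_rearrangement:
  fixes m :: "nat \<Rightarrow> nat"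
  assumes m: "\<forall>i\<in>{1..r}. m i = f \<or> m i = f + 1"
    and n: "(\<Sum>i\<in>{1..r}. m i) = r * f + k"
  shows "\<exists>g. bij_betw g {1..r} {1..r} \<and>
    (\<forall>i\<in>{1..r}. m (g i) = (if i \<le> k then f + 1 else f))"
proof -
  let ?S = "{i \<in> {1..r}. m i = f + 1}"
  have "(\<Sum>i\<in>{1..r}. m i) = (\<Sum>i\<in>{1..r}. f + of_bool (m i = f + 1))"
    using m by (intro sum.cong) auto
  also have "\<dots> = r * f + card ?S"
    by (simp add: sum.distrib sum_of_bool_eq Int_def)
  finally have card_S: "card ?S = k"
    using n by simp
  have "card ?S \<le> card {1..r}"
    by (intro card_mono) auto
  then have "k \<le> r"
    unfolding card_S by simp
  obtain g1 where g1: "bij_betw g1 {1..k} ?S"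
    using finite_same_card_bij[of "{1..k}" ?S] card_S by auto
  have "card ({1..r} - ?S) = r - k"
    using card_S by (subst card_Diff_subset) auto
  then obtain g2 where g2: "bij_betw g2 {k+1..r} ({1..r} - ?S)"
    using finite_same_card_bij[of "{k+1..r}" "{1..r} - ?S"] by auto
  define g where "g i = (if i \<le> k then g1 i else g2 i)" for i
  have g1': "bij_betw g {1..k} ?S"
    using g1 by (subst bij_betw_cong[of _ _ g1]) (auto simp: g_def)
  have g2': "bij_betw g {k+1..r} ({1..r} - ?S)"
    using g2 by (subst bij_betw_cong[of _ _ g2]) (auto simp: g_def)
  have "bij_betw g ({1..k} \<union> {k+1..r}) (?S \<union> ({1..r} - ?S))"
    using g1' g2' by (rule bij_betw_combine) blast
  moreover have "{1..k} \<union> {k+1..r} = {1..r}" "?S \<union> ({1..r} - ?S) = {1..r}"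
    using \<open>k \<le> r\<close> by auto
  ultimately have bij: "bij_betw g {1..r} {1..r}"
    by simp
  have "m (g i) = (if i \<le> k then f + 1 else f)" if i: "i \<in> {1..r}" for i
  proof (cases "i \<le> k")
    case True
    then have "g i \<in> ?S"
      by (intro bij_betw_apply[OF g1']) (use i in simp)
    then show ?thesis using True by simp
  next
    case False
    then have "g i \<in> {1..r} - ?S"
      by (intro bij_betw_apply[OF g2']) (use i in simp)
    then have "g i \<in> {1..r}" "m (g i) \<noteq> f + 1"
      by blast+
    then show ?thesis using False m by metis
  qed
  with bij show ?thesis
    by blast
qed

section \<open>The bound and its equality case\<close>

lemma walk_energy_le_balanced:
  assumes G: "pair_digraph G" and n: "n = card (pverts G)" and r: "r = dichromatic_number G"
  shows "real (walk_energy (pverts G) (parcs G)) \<le> balanced_energy n r"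
    and "real (walk_energy (pverts G) (parcs G)) = balanced_energy n r \<longleftrightarrow>
      is_join_of_transitive_tournaments G r
        (\<lambda>i. int (if i \<le> n mod r then n div r + 1 else n div r))" (is "?eq \<longleftrightarrow> ?join")
proof -
  interpret pair_digraph G by fact
  have sizes: "(\<Sum>i\<in>I. card (X i)) = card (\<Union>i\<in>I. X i)"
    if "finite I" "disjoint_family_on X I" "\<And>i. i \<in> I \<Longrightarrow> finite (X i)" for I and X :: "nat \<Rightarrow> 'a set"
    using that by (intro card_UN_disjoint[symmetric]) (auto simp: disjoint_family_on_def)
  obtain P where P: "partition_on (pverts G) P" "finite P" "card P = r"
    and acyc: "\<And>S. S \<in> P \<Longrightarrow> acyclic (parcs G \<inter> S \<times> S)"
    using dichromatic_partition[OF G] r by metis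
  obtain X where X: "bij_betw X {1..r} P"
    using finite_same_card_bij[of "{1..r}" P] P by auto
  have XP: "X i \<in> P" if "i \<in> {1..r}" for i
    using X that by (auto simp: bij_betw_def)
  have disj: "disjoint_family_on X {1..r}"
    unfolding disjoint_family_on_def
  proof (intro ballI impI)
    fix i j assume ij: "i \<in> {1..r}" "j \<in> {1..r}" "i \<noteq> j"
    then have "X i \<noteq> X j"
      using inj_onD[OF bij_betw_imp_inj_on[OF X], of i j] by blast
    with ij show "X i \<inter> X j = {}"
      using disjointD[OF partition_onD2[OF P(1)] XP XP] by simp
  qed
  have W: "pverts G = (\<Union>i\<in>{1..r}. X i)"
    using X partition_onD1[OF P(1)] by (simp add: bij_betw_def)
  have fin: "finite (X i)" if "i \<in> {1..r}" for i
  proof (rule finite_subset)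
    show "X i \<subseteq> pverts G"
      unfolding W using that by blast
  qed (rule pair_finite_verts)
  obtain h where h: "\<And>i. i \<in> {1..r} \<Longrightarrow> bij_betw h (X i) {..<card (X i)}"
    and desc: "\<And>i u v. i \<in> {1..r} \<Longrightarrow> (u, v) \<in> parcs G \<Longrightarrow> u \<in> X i \<Longrightarrow> v \<in> X i \<Longrightarrow> h v < h u"
    using common_ranking[OF disj fin acyc[OF XP]] by blast
  let ?M = "tournament_join {1..r} X h"
  \<comment> \<open>An arc within a part descends by the choice of \<open>h\<close>; an arc between
    two parts lies in \<open>?M\<close> outright.\<close>
  have sub: "parcs G \<subseteq> ?M"
  proof (rule subrelI)
    fix u v assume uv: "(u, v) \<in> parcs G"
    then obtain i j where "i \<in> {1..r}" "j \<in> {1..r}" "u \<in> X i" "v \<in> X j"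
      using wellformed'[OF uv] unfolding W by blast
    then show "(u, v) \<in> ?M"
      using desc uv unfolding tournament_join_def by blast
  qed
  have M: "?M \<subseteq> pverts G \<times> pverts G"
    unfolding W tournament_join_def by blast
  note mono = walk_energy_mono[OF pair_finite_verts M sub]
  have energy_M: "real (walk_energy (pverts G) ?M) = (\<Sum>i\<in>{1..r}. block_energy n (card (X i)))"
    unfolding n W by (rule walk_energy_tournament_join) (use disj fin h in auto)
  have card_X: "(\<Sum>i\<in>{1..r}. card (X i)) = n"
    unfolding n W by (rule sizes) (use disj fin in auto)
  note bal = sum_block_energy_le[OF finite_atLeastAtMost card_X, unfolded card_atLeastAtMost diff_Suc_1]
  show le: "real (walk_energy (pverts G) (parcs G)) \<le> balanced_energy n r"
    using mono(1) bal(1) energy_M by linarith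
  show "?eq \<longleftrightarrow> ?join"
  proof
    assume ?eq
    \<comment> \<open>Equality across a chain of two inequalities makes both of them equalities: the
      first gives \<open>parcs G = ?M\<close>, the second the balanced sizes.\<close>
    then have eq: "walk_energy (pverts G) (parcs G) = walk_energy (pverts G) ?M"
      and "(\<Sum>i\<in>{1..r}. block_energy n (card (X i))) = balanced_energy n r"
      using mono(1) bal(1) energy_M by linarith+
    note arcs = mono(2)[OF eq]
    have "\<forall>i\<in>{1..r}. card (X i) = n div r \<or> card (X i) = n div r + 1"
      using bal(2) \<open>(\<Sum>i\<in>{1..r}. block_energy n (card (X i))) = balanced_energy n r\<close> by (rule iffD1)
    moreover have "(\<Sum>i\<in>{1..r}. card (X i)) = r * (n div r) + n mod r"
      unfolding card_X by simp
    ultimately obtain g where g: "bij_betw g {1..r} {1..r}"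
      and card_g: "\<forall>i\<in>{1..r}. card (X (g i)) = (if i \<le> n mod r then n div r + 1 else n div r)"
      using balanced_rearrangement[of r "\<lambda>i. card (X i)"] by blast
    have g_in: "g i \<in> {1..r}" if "i \<in> {1..r}" for i
      using g that by (auto simp: bij_betw_def)
    have disj_g: "disjoint_family_on (X \<circ> g) {1..r}"
      unfolding disjoint_family_on_def
    proof (intro ballI impI)
      fix i j assume ij: "i \<in> {1..r}" "j \<in> {1..r}" "i \<noteq> j"
      then have "g i \<noteq> g j"
        using inj_onD[OF bij_betw_imp_inj_on[OF g], of i j] by blast
      then show "(X \<circ> g) i \<inter> (X \<circ> g) j = {}"
        using disjoint_family_onD[OF disj g_in[OF ij(1)] g_in[OF ij(2)]] by simp
    qed
    have verts_g: "pverts G = (\<Union>i\<in>{1..r}. (X \<circ> g) i)"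
      unfolding W by (subst bij_betw_imp_surj_on[OF g, symmetric]) (simp only: image_comp)
    have arcs_g: "parcs G = tournament_join {1..r} (X \<circ> g) h"
      unfolding tournament_join_reindex[OF g] by (rule arcs)
    show ?join
      unfolding is_join_iff_tournament_join
    proof (rule exI[of _ "X \<circ> g"], rule exI[of _ h], intro conjI ballI disj_g verts_g arcs_g)
      fix i assume i: "i \<in> {1..r}"
      show "finite ((X \<circ> g) i)" "bij_betw h ((X \<circ> g) i) {..<card ((X \<circ> g) i)}"
        using fin[OF g_in[OF i]] h[OF g_in[OF i]] by simp_all
      show "int (card ((X \<circ> g) i)) = int (if i \<le> n mod r then n div r + 1 else n div r)"
        using bspec[OF card_g i] by simp
    qed
  next
    assume ?join
    \<comment> \<open>Conversely, the energy is computed from the given join. Its parts are disjoint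
      and cover \<open>pverts G\<close>, so their sizes sum to \<open>n\<close> and the equality
      case of the concavity bound applies.\<close>
    then obtain Y k where Yk: "disjoint_family_on Y {1..r} \<and>
      (\<forall>i\<in>{1..r}. finite (Y i) \<and> bij_betw k (Y i) {..<card (Y i)} \<and>
        int (card (Y i)) = int (if i \<le> n mod r then n div r + 1 else n div r)) \<and>
      pverts G = (\<Union>i\<in>{1..r}. Y i) \<and> parcs G = tournament_join {1..r} Y k"
      unfolding is_join_iff_tournament_join by (elim exE)
    then have Y: "disjoint_family_on Y {1..r}"
      "\<And>i. i \<in> {1..r} \<Longrightarrow> finite (Y i)" "\<And>i. i \<in> {1..r} \<Longrightarrow> bij_betw k (Y i) {..<card (Y i)}"
      and sizes_Y: "\<And>i. i \<in> {1..r} \<Longrightarrow>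
        int (card (Y i)) = int (if i \<le> n mod r then n div r + 1 else n div r)"
      and GY: "pverts G = (\<Union>i\<in>{1..r}. Y i)" "parcs G = tournament_join {1..r} Y k"
      by metis+
    have "real (walk_energy (pverts G) (parcs G)) = (\<Sum>i\<in>{1..r}. block_energy n (card (Y i)))"
      unfolding n GY by (rule walk_energy_tournament_join) (use Y in auto)
    also have "\<dots> = balanced_energy n r"
    proof -
      have card_Y: "(\<Sum>i\<in>{1..r}. card (Y i)) = n"
        unfolding n GY(1) by (rule sizes) (use Y in auto)
      have "card (Y i) = n div r \<or> card (Y i) = n div r + 1" if "i \<in> {1..r}" for i
        using sizes_Y[OF that] by (auto split: if_splits)
      then have "\<forall>i\<in>{1..r}. card (Y i) = n div r \<or> card (Y i) = n div r + 1"
        by (rule ballI)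
      then show ?thesis
        by (rule sum_block_energy_le(2)[OF finite_atLeastAtMost card_Y,
            unfolded card_atLeastAtMost diff_Suc_1, THEN iffD2])
    qed
    finally show ?eq .
  qed
qed

section \<open>Closed forms of the balanced value\<close>

lemma balanced_energy_dvd:
  assumes r: "r > 0" and "r dvd n"
  shows "balanced_energy n r = (1 + 1 / (3 * (real r)\<^sup>2) - 1 / real r) * (real n) ^ 3
    - 1 / (2 * real r) * (real n)\<^sup>2 + 1 / 6 * real n"
proof -
  obtain k where k: "n = r * k"
    using \<open>r dvd n\<close> by blast
  have k_eq: "n div r = k" "n mod r = 0" "real n = real r * real k"
    using k r by simp_all
  \<comment> \<open>A polynomial identity over the reals, with \<open>R\<close> and \<open>a\<close>
    standing for \<open>r\<close> and \<open>n div r\<close>; \<open>R > 0\<close> allows the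
    denominators to cancel.\<close>
  have "R * ((R * a)\<^sup>2 * a - R * a * a\<^sup>2 + a ^ 3 / 3 - a\<^sup>2 / 2 + a / 6)
      = (1 + 1 / (3 * R\<^sup>2) - 1 / R) * (R * a) ^ 3 - 1 / (2 * R) * (R * a)\<^sup>2 + 1 / 6 * (R * a)"
    if "R > 0" for R a :: real
    using that
    by (simp add: power2_eq_square power3_eq_cube add_divide_distrib diff_divide_distrib algebra_simps)
  from this[of "real r" "real k", unfolded of_nat_0_less_iff, OF r] show ?thesis
    unfolding balanced_energy_def block_energy_def Let_def k_eq of_nat_0 mult_zero_left add_0_right .
qed

text \<open>In \<open>block_energy n m\<close> the terms \<open>n^2 m\<close> and
  \<open>m / 6\<close> add up over all parts to \<open>n^3\<close> and \<open>n / 6\<close>, leaving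
  \<open>m^2 (m / 3 - n - 1 / 2)\<close>. For \<open>r > 0\<close> there are \<open>n - r f\<close>
  parts of size \<open>f + 1\<close> and \<open>r (f + 1) - n\<close> of size \<open>f\<close>,
  whence the minus sign before the last product.\<close>

lemma balanced_energy_explicit:
  fixes n r :: nat
  defines "f \<equiv> int (n div r)"
  shows "balanced_energy n r = real n ^ 3 + 1 / 6 * real n
    + (real_of_int (f + 1))\<^sup>2 * (real n - real r * real_of_int f)
        * (1 / 3 * real_of_int (f + 1) - real n - 1 / 2)
    - (real_of_int f)\<^sup>2 * (real n - real r * real_of_int (f + 1))
        * (1 / 3 * real_of_int f - real n - 1 / 2)"
proof -
  have poly: "R * (N\<^sup>2 * a - N * a\<^sup>2 + a ^ 3 / 3 - a\<^sup>2 / 2 + a / 6) + (N - R * a) *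
      ((N\<^sup>2 * (a + 1) - N * (a + 1)\<^sup>2 + (a + 1) ^ 3 / 3 - (a + 1)\<^sup>2 / 2 + (a + 1) / 6)
        - (N\<^sup>2 * a - N * a\<^sup>2 + a ^ 3 / 3 - a\<^sup>2 / 2 + a / 6))
    = N ^ 3 + 1 / 6 * N + (a + 1)\<^sup>2 * (N - R * a) * (1 / 3 * (a + 1) - N - 1 / 2)
      - a\<^sup>2 * (N - R * (a + 1)) * (1 / 3 * a - N - 1 / 2)" for N R a :: real
    by (simp add: power2_eq_square power3_eq_cube add_divide_distrib diff_divide_distrib algebra_simps)
  have "real n = real r * real (n div r) + real (n mod r)"
    by (metis mult_div_mod_eq of_nat_add of_nat_mult)
  then have m: "real (n mod r) = real n - real r * real (n div r)"
    by linarith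
  show ?thesis
    unfolding f_def balanced_energy_def block_energy_def Let_def of_int_add of_int_of_nat_eq
      of_int_1 of_nat_add of_nat_1 m by (rule poly)
qed

lemma is_join_cong:
  assumes "\<And>i. i \<in> {1..r} \<Longrightarrow> m i = m' i"
  shows "is_join_of_transitive_tournaments G r m \<longleftrightarrow> is_join_of_transitive_tournaments G r m'"
  unfolding is_join_of_transitive_tournaments_def using assms by simp

theorem theorem2p11:
  fixes G :: "'a pair_pre_digraph" and vs :: "'a list" and n r :: nat
  assumes "pair_digraph G" and "connected (with_proj G)"
    and "distinct vs" and "set vs = pverts G"
    and "n = card (pverts G)" and "r = dichromatic_number G"
  shows
    "(r dvd n \<longrightarrow>
       (let b = (1 + 1 / (3 * (real r)\<^sup>2) - 1 / real r) * (real n) ^ 3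
                  - 1 / (2 * real r) * (real n)\<^sup>2 + 1 / 6 * real n
        in laplacian_energy G vs \<le> complex_of_real b \<and>
           (laplacian_energy G vs = complex_of_real b \<longleftrightarrow>
              is_join_of_transitive_tournaments G r (\<lambda>i. int (n div r)))))
     \<and>
     (\<not> r dvd n \<longrightarrow>
       (let c = \<lceil>real n / real r\<rceil>;
            f = \<lfloor>real n / real r\<rfloor>;
            p = (real_of_int c)\<^sup>2 * (real n - real r * real_of_int f)
                  * (1 / 3 * real_of_int c - real n - 1 / 2);
            q = (real_of_int f)\<^sup>2 * (real n - real r * real_of_int c)
                  * (1 / 3 * real_of_int f - real n - 1 / 2);
            b = (real n) ^ 3 + 1 / 6 * real n + p - q
        in laplacian_energy G vs \<le> complex_of_real b \<and>
           (laplacian_energy G vs = complex_of_real b \<longleftrightarrow>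
              is_join_of_transitive_tournaments G r
                (\<lambda>i. if int i \<le> int n - int r * f then c else f))))"
proof -
  let ?E = "real (walk_energy (pverts G) (parcs G))"
  have energy: "laplacian_energy G vs = complex_of_real ?E"
    using laplacian_energy_eq_walk_energy[OF assms(1,3,4)] by simp
  note bound = walk_energy_le_balanced[OF assms(1,5,6)]
  obtain P where "partition_on (pverts G) P" "finite P" "card P = r"
    unfolding assms(6) by (rule dichromatic_partition[OF assms(1)])
  \<comment> \<open>\<open>connected\<close> demands a vertex, and a partition of a nonempty set has
    at least one part, so \<open>r\<close> is positive.\<close>
  moreover have "pverts G \<noteq> {}"
    using assms(2) by (auto simp: connected_def strongly_connected_def)
  ultimately have r: "r > 0"
    by (auto simp: partition_on_def card_gt_0_iff)
  \<comment> \<open>Both cases have this form: a closed form of \<open>balanced_energy n r\<close>,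
    and a size function that agrees with the balanced one on \<open>{1..r}\<close>.\<close>
  have key: "laplacian_energy G vs \<le> complex_of_real b \<and>
      (laplacian_energy G vs = complex_of_real b \<longleftrightarrow> is_join_of_transitive_tournaments G r m)"
    if "b = balanced_energy n r"
      and "\<And>i. i \<in> {1..r} \<Longrightarrow> int (if i \<le> n mod r then n div r + 1 else n div r) = m i" for b m
  proof
    show "laplacian_energy G vs \<le> complex_of_real b"
      using bound(1) unfolding energy that(1) by (simp add: less_eq_complex_def)
    have "laplacian_energy G vs = complex_of_real b \<longleftrightarrow> ?E = balanced_energy n r"
      unfolding energy that(1) by (rule of_real_eq_iff)
    also note bound(2)
    also have "is_join_of_transitive_tournaments G r
        (\<lambda>i. int (if i \<le> n mod r then n div r + 1 else n div r)) \<longleftrightarrow>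
        is_join_of_transitive_tournaments G r m"
      using that(2) by (rule is_join_cong)
    finally show "laplacian_energy G vs = complex_of_real b \<longleftrightarrow>
        is_join_of_transitive_tournaments G r m" .
  qed
  show ?thesis
  proof (intro conjI impI)
    assume dvd: "r dvd n"
    show "let b = (1 + 1 / (3 * (real r)\<^sup>2) - 1 / real r) * (real n) ^ 3
                  - 1 / (2 * real r) * (real n)\<^sup>2 + 1 / 6 * real n
        in laplacian_energy G vs \<le> complex_of_real b \<and>
           (laplacian_energy G vs = complex_of_real b \<longleftrightarrow>
              is_join_of_transitive_tournaments G r (\<lambda>i. int (n div r)))"
      \<comment> \<open>Here \<open>n mod r = 0\<close> and indices start at \<open>1\<close>, so no
        index satisfies \<open>i \<le> n mod r\<close> and all sizes are
        \<open>n div r\<close>.\<close>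
      unfolding Let_def
      by (rule key[OF balanced_energy_dvd[OF r dvd, symmetric]]) (use dvd in simp)
  next
    assume nd: "\<not> r dvd n"
    let ?f = "n div r"
    have f: "\<lfloor>real n / real r\<rfloor> = int ?f"
      by (simp add: floor_divide_of_nat_eq)
    \<comment> \<open>The ceiling exceeds the floor by one because the quotient is not an integer:
      otherwise \<open>n = r * ?f\<close>, and \<open>r\<close> would divide
      \<open>n\<close>.\<close>
    have c: "\<lceil>real n / real r\<rceil> = int ?f + 1"
    proof -
      have "real n / real r \<noteq> real_of_int (int ?f)"
      proof
        assume "real n / real r = real_of_int (int ?f)"
        then have "real n = real (r * ?f)"
          using r by (simp add: field_simps)
        then have "n = r * ?f"
          by (simp only: of_nat_eq_iff)
        with nd show False
          by (metis dvd_triv_left)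
      qed
      then show ?thesis
        using f by (metis ceiling_altdef)
    qed
    have mod: "int n - int r * int ?f = int (n mod r)"
      by (simp flip: of_nat_mult of_nat_diff add: minus_mult_div_eq_mod)
    show "let c = \<lceil>real n / real r\<rceil>;
            f = \<lfloor>real n / real r\<rfloor>;
            p = (real_of_int c)\<^sup>2 * (real n - real r * real_of_int f)
                  * (1 / 3 * real_of_int c - real n - 1 / 2);
            q = (real_of_int f)\<^sup>2 * (real n - real r * real_of_int c)
                  * (1 / 3 * real_of_int f - real n - 1 / 2);
            b = (real n) ^ 3 + 1 / 6 * real n + p - q
        in laplacian_energy G vs \<le> complex_of_real b \<and>
           (laplacian_energy G vs = complex_of_real b \<longleftrightarrow>
              is_join_of_transitive_tournaments G r
                (\<lambda>i. if int i \<le> int n - int r * f then c else f))"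
      unfolding Let_def f c by (rule key[OF balanced_energy_explicit[symmetric]]) (simp add: mod)
  qed
qed

end
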